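(* Let $\{x^k\}_{k\ge 0}$ be a sequence generated by the accelerated proximal gradient method with parameters $a\in[0,1)$, $b\in[a^2/4,1/4]$, $\ell\ge L$ and starting point $x^0\in\operatorname{dom}F$ described in the context. Then the following hold: (i) $F_i(x^k)\le F_i(x^0)$ for all $i=1,\dots,m$ and all $k\ge 0$; (ii) under Assumption (B) stated in the context, $u_0(x^k)=O(1/k^2)$ as $k\to\infty$.
   Context: Setting: $m\ge 1$, $F=(F_1,\dots,F_m)^\top:\mathbf{R}^n\to(\mathbf{R}\cup\{\infty\})^m$ with $F_i=f_i+g_i$, where each $f_i:\mathbf{R}^n\to\mathbf{R}$ is convex and continuously differentiable with $\nabla f_i$ Lipschitz continuous with constant $L_i>0$, and each $g_i:\mathbf{R}^n\to\mathbf{R}\cup\{\infty\}$ is closed, proper and convex. Put $L:=\max_i L_i$. The norm is Euclidean. For vectors, $v^1\le v^2$ (resp. $v^1<v^2$) means $v^1_i\le v^2_i$ (resp. $v^1_i<v^2_i$) for every $i$. $\operatorname{dom}F:=\{x: F(x)<\infty\}$ (all components finite). Weakly Pareto optimal set: $X^\ast:=\{x^\ast\in\mathbf{R}^n : \text{there is no } x\in\mathbf{R}^n \text{ with } F(x)<F(x^\ast)\}$. Level set: $\mathcal{L}_F(c):=\{x\in\mathbf{R}^n: F(x)\le c\}$. $F(A)$ and $F^{-1}(B)$ denote image and inverse image. Merit function: $u_0(x):=\sup_{z\in\mathbf{R}^n}\min_{i=1,\dots,m}[F_i(x)-F_i(z)]$ (with $F_i(x)-F_i(z)=-\infty$ if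 $F_i(x)<\infty=F_i(z)$). Algorithm: for $\ell\ge L$, $x\in\operatorname{dom}F$, $y\in\mathbf{R}^n$ let $p_\ell(x,y)$ be the unique minimizer over $z\in\mathbf{R}^n$ of $$\max_{i=1,\dots,m}\big[\langle\nabla f_i(y),z-y\rangle+g_i(z)+f_i(y)-F_i(x)\big]+\tfrac{\ell}{2}\|z-y\|^2 .$$ Given $a\in[0,1)$, $b\in[a^2/4,1/4]$, set $x^0=y^1\in\operatorname{dom}F$, $t_1=1$ and for $k=1,2,\dots$ $$x^k=p_\ell(x^{k-1},y^k),\quad t_{k+1}=\sqrt{t_k^2-at_k+b}+\tfrac12,\quad \gamma_k=\frac{t_k-1}{t_{k+1}},\quad y^{k+1}=x^k+\gamma_k(x^k-x^{k-1}).$$ The generated sequences are infinite (no stopping test). Assumption (B): for every $x\in\mathcal{L}_F(F(x^0))$ there exists $x^\ast\in X^\ast$ with $F(x^\ast)\le F(x)$, and $$R:=\sup_{F^\ast\in F(X^\ast\cap\mathcal{L}_F(F(x^0)))}\ \inf_{z\in F^{-1}(\{F^\ast\})}\|z-x^0\|^2<\infty .$$ *)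

theory Defs
  imports "HOL-Analysis.Analysis" "HOL-Library.Landau_Symbols"
begin

text \<open>
  Functions into \<open>\<real> \<union> {\<infinity>}\<close> are \<^typ>\<open>ereal\<close>-valued functions that avoid \<open>-\<infinity>\<close> (part of
  properness). Convexity and closedness are, as usual in convex analysis, those of the epigraph.
\<close>

definition ext_epigraph :: "('a \<Rightarrow> ereal) \<Rightarrow> ('a \<times> real) set"
  where "ext_epigraph g = {(x, r). g x \<le> ereal r}"

definition ext_proper :: "('a \<Rightarrow> ereal) \<Rightarrow> bool"
  where "ext_proper g \<longleftrightarrow> (\<forall>x. g x \<noteq> -\<infinity>) \<and> (\<exists>x. g x < \<infinity>)"

definition ext_closed :: "('a::euclidean_space \<Rightarrow> ereal) \<Rightarrow> bool"
  where "ext_closed g \<longleftrightarrow> closed (ext_epigraph g)"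

definition ext_convex :: "('a::euclidean_space \<Rightarrow> ereal) \<Rightarrow> bool"
  where "ext_convex g \<longleftrightarrow> convex (ext_epigraph g)"

definition vobj :: "('m \<Rightarrow> 'a \<Rightarrow> real) \<Rightarrow> ('m \<Rightarrow> 'a \<Rightarrow> ereal) \<Rightarrow> 'a \<Rightarrow> 'm \<Rightarrow> ereal"
  where "vobj f g x = (\<lambda>i. ereal (f i x) + g i x)"

definition vdom :: "('a \<Rightarrow> 'm \<Rightarrow> ereal) \<Rightarrow> 'a set"
  where "vdom F = {x. \<forall>i. F x i < \<infinity>}"

text \<open>
  The order \<open><\<close> on vectors is strict in every component; it is not the strict part of the
  pointwise order on functions, so it is spelled out.
\<close>

definition weakly_pareto :: "('a \<Rightarrow> 'm \<Rightarrow> ereal) \<Rightarrow> 'a set"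
  where "weakly_pareto F = {xs. \<not> (\<exists>x. \<forall>i. F x i < F xs i)}"

definition level_set :: "('a \<Rightarrow> 'm \<Rightarrow> ereal) \<Rightarrow> ('m \<Rightarrow> ereal) \<Rightarrow> 'a set"
  where "level_set F c = {x. \<forall>i. F x i \<le> c i}"

text \<open>
  Subtraction on \<^typ>\<open>ereal\<close> gives \<open>r - \<infinity> = -\<infinity>\<close> for \<open>r < \<infinity>\<close>, as required. The case
  \<open>\<infinity> - \<infinity>\<close> (\<open>= \<infinity>\<close> in \<^typ>\<open>ereal\<close>) only concerns points outside the domain of \<open>F\<close>.
\<close>

definition merit :: "('a \<Rightarrow> 'm::finite \<Rightarrow> ereal) \<Rightarrow> 'a \<Rightarrow> ereal"
  where "merit F x = (SUP z. Min (range (\<lambda>i. F x i - F z i)))"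

text \<open>In the following, \<open>df i\<close> stands for the gradient of \<open>f i\<close>.\<close>

definition prox_objective ::
    "('m::finite \<Rightarrow> 'a::euclidean_space \<Rightarrow> real) \<Rightarrow> ('m \<Rightarrow> 'a \<Rightarrow> 'a) \<Rightarrow> ('m \<Rightarrow> 'a \<Rightarrow> ereal) \<Rightarrow>
      real \<Rightarrow> 'a \<Rightarrow> 'a \<Rightarrow> 'a \<Rightarrow> ereal"
  where "prox_objective f df g l x y z =
    Max (range (\<lambda>i. ereal (df i y \<bullet> (z - y)) + g i z + ereal (f i y) - vobj f g x i))
      + ereal (l / 2 * (norm (z - y))\<^sup>2)"

definition prox_point ::
    "('m::finite \<Rightarrow> 'a::euclidean_space \<Rightarrow> real) \<Rightarrow> ('m \<Rightarrow> 'a \<Rightarrow> 'a) \<Rightarrow> ('m \<Rightarrow> 'a \<Rightarrow> ereal) \<Rightarrow>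
      real \<Rightarrow> 'a \<Rightarrow> 'a \<Rightarrow> 'a"
  where "prox_point f df g l x y = (THE z. is_arg_min (prox_objective f df g l x y) (\<lambda>_. True) z)"

text \<open>The sequences \<open>y\<close> and \<open>t\<close> start at index 1; their values at 0 are irrelevant.\<close>

definition apg_sequence ::
    "('m::finite \<Rightarrow> 'a::euclidean_space \<Rightarrow> real) \<Rightarrow> ('m \<Rightarrow> 'a \<Rightarrow> 'a) \<Rightarrow> ('m \<Rightarrow> 'a \<Rightarrow> ereal) \<Rightarrow>
      real \<Rightarrow> real \<Rightarrow> real \<Rightarrow> (nat \<Rightarrow> 'a) \<Rightarrow> (nat \<Rightarrow> 'a) \<Rightarrow> (nat \<Rightarrow> real) \<Rightarrow> bool"
  where "apg_sequence f df g l a b x y t \<longleftrightarrow>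
    x 0 \<in> vdom (vobj f g) \<and> y 1 = x 0 \<and> t 1 = 1 \<and>
    (\<forall>k\<ge>1. x k = prox_point f df g l (x (k - 1)) (y k) \<and>
           t (k + 1) = sqrt ((t k)\<^sup>2 - a * t k + b) + 1 / 2 \<and>
           y (k + 1) = x k + ((t k - 1) / t (k + 1)) *\<^sub>R (x k - x (k - 1)))"

definition assumption_B :: "('a::euclidean_space \<Rightarrow> 'm \<Rightarrow> ereal) \<Rightarrow> 'a \<Rightarrow> bool"
  where "assumption_B F x0 \<longleftrightarrow>
    (\<forall>x\<in>level_set F (F x0). \<exists>xs\<in>weakly_pareto F. \<forall>i. F xs i \<le> F x i) \<and>
    (SUP Fs\<in>F ` (weakly_pareto F \<inter> level_set F (F x0)).
       INF z\<in>F -` {Fs}. ereal ((norm (z - x0))\<^sup>2)) < \<infinity>"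

end

theory Submission imports Defs begin

text \<open>
  For a point \<open>z\<close> let \<open>\<sigma>\<^sub>k(z) = min\<^sub>i (F\<^sub>i(x\<^sub>k) - F\<^sub>i(z))\<close>, so that the merit function at \<open>x\<^sub>k\<close> is the
  supremum of \<open>\<sigma>\<^sub>k\<close>, and let \<open>d\<^sub>k = \<parallel>x\<^sub>k - x\<^sub>k\<^sub>-\<^sub>1\<parallel>\<^sup>2\<close>. Strong convexity of the subproblem, together with
  the quadratic upper and affine lower bounds on the smooth parts (\<open>prox_point_step\<close>), gives two estimates
  for each step, one with comparison point \<open>x\<^sub>k\<close> and one with comparison point \<open>z\<close>:
  \<open>\<sigma>\<^sub>k\<^sub>+\<^sub>1(z) - \<sigma>\<^sub>k(z) \<le> l/2 (\<parallel>y\<^sub>k\<^sub>+\<^sub>1 - x\<^sub>k\<parallel>\<^sup>2 - d\<^sub>k\<^sub>+\<^sub>1)\<close> and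
  \<open>\<sigma>\<^sub>k\<^sub>+\<^sub>1(z) \<le> l/2 (\<parallel>y\<^sub>k\<^sub>+\<^sub>1 - z\<parallel>\<^sup>2 - \<parallel>x\<^sub>k\<^sub>+\<^sub>1 - z\<parallel>\<^sup>2)\<close>.

  The first holds for each objective separately as well. As the momentum coefficient is at most one,
  every \<open>F\<^sub>i(x\<^sub>k) + l/2 d\<^sub>k\<close> is nonincreasing, which is the first claim.

  For the rate, the two estimates are combined as in the analysis of the accelerated proximal
  gradient method: \<open>t\<^sub>k\<^sup>2 \<sigma>\<^sub>k + l/2 \<parallel>t\<^sub>k x\<^sub>k - (t\<^sub>k - 1) x\<^sub>k\<^sub>-\<^sub>1 - z\<parallel>\<^sup>2\<close> changes by at most \<open>- w\<^sub>k \<sigma>\<^sub>k\<close>, where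
  \<open>w\<^sub>k = a t\<^sub>k + 1/4 - b\<close> is nonnegative (\<open>weighted_step\<close>). With one objective and \<open>z\<close> a minimizer, \<open>\<sigma>\<^sub>k\<close> is
  nonnegative and this suffices; here \<open>\<sigma>\<^sub>k(z)\<close> may be negative at intermediate iterates. The remedy is
  to add \<open>(w\<^sub>1 + \<dots> + w\<^sub>k\<^sub>-\<^sub>1) (\<sigma>\<^sub>k + l/2 d\<^sub>k)\<close>. The energy \<open>\<sigma>\<^sub>k + l/2 d\<^sub>k\<close> dissipates at least \<open>l/2 d\<^sub>k / t\<^sub>k\<close> per
  step (\<open>extrapolation_contracts\<close>), and \<open>t\<^sub>k w\<^sub>k \<le> w\<^sub>1 + \<dots> + w\<^sub>k\<close> (\<open>t_mult_slack_le_slack_sum\<close>), so the sum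
  is nonincreasing (\<open>lyapunov_Suc_le\<close>). Hence \<open>t\<^sub>k\<^sup>2 \<sigma>\<^sub>k(z) \<le> l/2 \<parallel>z - x\<^sub>0\<parallel>\<^sup>2\<close> whenever \<open>\<sigma>\<^sub>k(z) \<ge> 0\<close>, and \<open>t\<^sub>k\<close>
  grows linearly because \<open>a < 1\<close>.

  Finally, Assumption (B) turns the factor \<open>\<parallel>z - x\<^sub>0\<parallel>\<^sup>2\<close> into a constant (\<open>merit_le\<close>): weakly Pareto
  optimal points suffice for the supremum, and only their values under \<open>F\<close> matter.
\<close>

section \<open>First-order bounds for smooth functions\<close>

lemma GDERIV_along_segment:
  fixes f :: "'a::euclidean_space \<Rightarrow> real"
  assumes "\<And>z. GDERIV f z :> df z"
  shows "((\<lambda>s. f (y + s *\<^sub>R v)) has_field_derivative df (y + s *\<^sub>R v) \<bullet> v) (at s)"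
proof -
  have "((\<lambda>s. y + s *\<^sub>R v) has_derivative (\<lambda>s. s *\<^sub>R v)) (at s)"
    by (auto intro!: derivative_eq_intros)
  from has_derivative_compose[OF this assms[of "y + s *\<^sub>R v", unfolded gderiv_def]]
  show ?thesis
    unfolding has_field_derivative_def by (rule has_derivative_eq_rhs) (simp add: fun_eq_iff inner_commute)
qed

text \<open>
  Restricted to the line through \<open>y\<close> and \<open>z\<close>, a convex function lies above its tangent.
\<close>

lemma convex_gradient_minorant:
  fixes f :: "'a::euclidean_space \<Rightarrow> real"
  assumes "convex_on UNIV f" and "\<And>z. GDERIV f z :> df z"
  shows "f y + df y \<bullet> (z - y) \<le> f z"
proof -
  define \<phi> where "\<phi> = (\<lambda>s. f (y + s *\<^sub>R (z - y)))"
  have conv: "convex_on UNIV \<phi>"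
  proof (intro convex_onI)
    fix s p q :: real assume s: "0 < s" "s < 1"
    have "y + ((1 - s) * p + s * q) *\<^sub>R (z - y)
        = (1 - s) *\<^sub>R (y + p *\<^sub>R (z - y)) + s *\<^sub>R (y + q *\<^sub>R (z - y))"
      by (simp add: algebra_simps)
    then show "\<phi> ((1 - s) *\<^sub>R p + s *\<^sub>R q) \<le> (1 - s) * \<phi> p + s * \<phi> q"
      using convex_onD[OF assms(1), of s "y + p *\<^sub>R (z - y)" "y + q *\<^sub>R (z - y)"] s
      by (simp add: \<phi>_def)
  qed simp
  have "(\<phi> has_field_derivative df y \<bullet> (z - y)) (at 0)"
    using GDERIV_along_segment[OF assms(2), of y "z - y" 0] by (simp add: \<phi>_def)
  with convex_on_imp_above_tangent[OF conv, of 0 1 "df y \<bullet> (z - y)"] show ?thesis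
    by (simp add: \<phi>_def)
qed

text \<open>
  Subtracting the right-hand side along the segment from \<open>y\<close> to \<open>z\<close> leaves a function whose
  derivative \<open>\<langle>df (y + s (z - y)) - df y, z - y\<rangle> - L s \<parallel>z - y\<parallel>\<^sup>2\<close> is nonpositive, by Cauchy-Schwarz and the
  Lipschitz bound.
\<close>

lemma lipschitz_gradient_majorant:
  fixes f :: "'a::euclidean_space \<Rightarrow> real"
  assumes "\<And>z. GDERIV f z :> df z" and "L-lipschitz_on UNIV df"
  shows "f z \<le> f y + df y \<bullet> (z - y) + L / 2 * (norm (z - y))\<^sup>2"
proof -
  define \<phi> where "\<phi> = (\<lambda>s. f (y + s *\<^sub>R (z - y)) - s * (df y \<bullet> (z - y)) - L / 2 * s\<^sup>2 * (norm (z - y))\<^sup>2)"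
  define \<phi>' where "\<phi>' = (\<lambda>s. df (y + s *\<^sub>R (z - y)) \<bullet> (z - y) - df y \<bullet> (z - y) - L * s * (norm (z - y))\<^sup>2)"
  have "\<phi> 1 \<le> \<phi> 0"
  proof (rule DERIV_nonpos_imp_nonincreasing[where f = \<phi>])
    fix s :: real assume s: "0 \<le> s" "s \<le> 1"
    have "(\<phi> has_field_derivative \<phi>' s) (at s)"
      unfolding \<phi>_def \<phi>'_def
      by (auto intro!: derivative_eq_intros GDERIV_along_segment[OF assms(1)])
    moreover have "\<phi>' s \<le> 0"
    proof -
      have "df (y + s *\<^sub>R (z - y)) \<bullet> (z - y) - df y \<bullet> (z - y)
          \<le> norm (df (y + s *\<^sub>R (z - y)) - df y) * norm (z - y)"
        using norm_cauchy_schwarz by (simp flip: inner_diff_left)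
      also have "\<dots> \<le> (L * (s * norm (z - y))) * norm (z - y)"
        using lipschitz_onD[OF assms(2), of "y + s *\<^sub>R (z - y)" y] s
        by (intro mult_right_mono) (auto simp: dist_norm)
      finally show ?thesis by (simp add: \<phi>'_def power2_eq_square mult_ac)
    qed
    ultimately show "\<exists>d. (\<phi> has_real_derivative d) (at s) \<and> d \<le> 0" by blast
  qed simp
  then show ?thesis by (simp add: \<phi>_def)
qed

section \<open>Proximal minimization of closed convex functions\<close>

lemma ext_convexD:
  assumes "ext_convex h" "h u \<le> ereal r" "h v \<le> ereal q" "0 \<le> s" "s \<le> 1"
  shows "h ((1 - s) *\<^sub>R u + s *\<^sub>R v) \<le> ereal ((1 - s) * r + s * q)"
  using convexD_alt[of "ext_epigraph h" "(u, r)" "(v, q)" s] assms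
  by (auto simp: ext_convex_def ext_epigraph_def)

text \<open>
  A point strictly below the graph is separated from the closed convex epigraph by a hyperplane. The
  hyperplane cannot be vertical because the point is taken directly below a point of the graph, so
  it is itself the graph of an affine function.
\<close>

lemma ext_convex_affine_minorant:
  fixes h :: "'a::euclidean_space \<Rightarrow> ereal"
  assumes "ext_closed h" "ext_convex h" "ext_proper h"
  obtains p c where "\<And>z. ereal (p \<bullet> z + c) \<le> h z"
proof -
  obtain u r where r: "h u = ereal r"
    using assms(3) unfolding ext_proper_def by (metis ereal_cases less_irrefl)
  then have "(u, r - 1) \<notin> ext_epigraph h" by (simp add: ext_epigraph_def)
  with assms obtain w \<beta> where w: "w \<bullet> (u, r - 1) < \<beta>" "\<And>e. e \<in> ext_epigraph h \<Longrightarrow> w \<bullet> e > \<beta>"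
    using separating_hyperplane_closed_point[of "ext_epigraph h" "(u, r - 1)"]
    unfolding ext_closed_def ext_convex_def by blast
  obtain p q where pq: "w = (p, q)" by (cases w)
  have "(u, r) \<in> ext_epigraph h" using r by (simp add: ext_epigraph_def)
  from w(2)[OF this] w(1) have q: "q > 0" by (simp add: pq algebra_simps)
  have "ereal ((- p /\<^sub>R q) \<bullet> z + \<beta> / q) \<le> h z" for z
  proof (cases "h z")
    case (real s)
    then have "p \<bullet> z + q * s > \<beta>" using w(2)[of "(z, s)"] by (simp add: ext_epigraph_def pq)
    then show ?thesis using real q by (simp add: field_simps)
  next
    case MInf
    then show ?thesis using assms(3) by (simp add: ext_proper_def)
  qed simp
  then show thesis by (rule that)
qed

text \<open>
  The squared distance to \<open>y\<close> is strongly convex, with an exact defect.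
\<close>

lemma norm_convex_combination:
  fixes u v y :: "'a::real_inner"
  shows "(norm ((1 - s) *\<^sub>R u + s *\<^sub>R v - y))\<^sup>2
    = (1 - s) * (norm (u - y))\<^sup>2 + s * (norm (v - y))\<^sup>2 - s * (1 - s) * (norm (v - u))\<^sup>2"
  by (simp add: power2_norm_eq_inner inner_simps inner_commute algebra_simps)

text \<open>
  Comparing the minimizer \<open>p\<close> with \<open>(1 - s) p + s z\<close> and dividing by \<open>s\<close> gives the inequality with
  the factor \<open>1 - s\<close> in front of the last term on the left; then \<open>s\<close> tends to \<open>0\<close>. This
  inequality and the finiteness of \<open>h p\<close> are all that the convergence analysis uses about \<open>p\<close>.
\<close>

lemma arg_min_regularized_three_point:
  fixes h :: "'a::euclidean_space \<Rightarrow> ereal"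
  assumes h: "ext_convex h" "ext_proper h"
    and p: "is_arg_min (\<lambda>z. h z + ereal (l / 2 * (norm (z - y))\<^sup>2)) (\<lambda>_. True) p"
  shows "\<bar>h p\<bar> \<noteq> \<infinity>"
    and "h p + ereal (l / 2 * (norm (p - y))\<^sup>2 + l / 2 * (norm (z - p))\<^sup>2)
      \<le> h z + ereal (l / 2 * (norm (z - y))\<^sup>2)"
proof -
  have min: "h p + ereal (l / 2 * (norm (p - y))\<^sup>2) \<le> h w + ereal (l / 2 * (norm (w - y))\<^sup>2)" for w
    using p by (auto simp: is_arg_min_linorder)
  obtain u where u: "h u < \<infinity>" using h(2) by (auto simp: ext_proper_def)
  have minf: "h w \<noteq> -\<infinity>" for w using h(2) by (auto simp: ext_proper_def)
  show fin: "\<bar>h p\<bar> \<noteq> \<infinity>" using min[of u] u minf[of p] by (cases "h p"; cases "h u") auto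
  then obtain r where r: "h p = ereal r" by auto
  show "h p + ereal (l / 2 * (norm (p - y))\<^sup>2 + l / 2 * (norm (z - p))\<^sup>2)
      \<le> h z + ereal (l / 2 * (norm (z - y))\<^sup>2)"
  proof (cases "h z")
    case (real q)
    define P where "P = r + l / 2 * (norm (p - y))\<^sup>2"
    define Q where "Q = q + l / 2 * (norm (z - y))\<^sup>2"
    define D where "D = l / 2 * (norm (z - p))\<^sup>2"
    have le: "P + (1 - s) * D \<le> Q" if s: "0 < s" "s < 1" for s
    proof -
      let ?w = "(1 - s) *\<^sub>R p + s *\<^sub>R z"
      have "ereal P \<le> h ?w + ereal (l / 2 * (norm (?w - y))\<^sup>2)"
        using min[of ?w] by (simp add: r P_def)
      also have "\<dots> \<le> ereal ((1 - s) * r + s * q) + ereal (l / 2 * (norm (?w - y))\<^sup>2)"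
        using ext_convexD[OF h(1), of p r z q s] s r real by (intro add_right_mono) auto
      also have "\<dots> = ereal ((1 - s) * P + s * Q - s * (1 - s) * D)"
      proof -
        have "((1 - s) * r + s * q) + \<kappa> * ((1 - s) * A + s * B - s * (1 - s) * C)
            = (1 - s) * (r + \<kappa> * A) + s * (q + \<kappa> * B) - s * (1 - s) * (\<kappa> * C)" for \<kappa> A B C
          by (simp add: algebra_simps)
        then show ?thesis
          unfolding norm_convex_combination plus_ereal.simps P_def Q_def D_def by (rule arg_cong)
      qed
      finally have "s * (P + (1 - s) * D) \<le> s * Q" by (simp add: algebra_simps)
      then show ?thesis using s by simp
    qed
    have "((\<lambda>s. P + (1 - s) * D) \<longlongrightarrow> P + (1 - 0) * D) (at_right 0)"
      by (intro tendsto_intros)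
    moreover have "\<forall>\<^sub>F s in at_right 0. P + (1 - s) * D \<le> Q"
      using le eventually_at_right_less[of "0::real"]
      by (auto simp: eventually_at_right_field intro!: exI[of _ 1])
    ultimately have "P + (1 - 0) * D \<le> Q" by (rule tendsto_upperbound) simp
    then show ?thesis by (simp add: r real P_def Q_def D_def algebra_simps)
  qed (use minf[of z] in auto)
qed

text \<open>
  The minimum is sought as the lowest point of the epigraph. The quadratic term dominates the affine
  minorant of \<open>h\<close>, so the part of the epigraph below a fixed height is bounded, hence compact, and
  the height attains its infimum there. Uniqueness is the three-point inequality applied to two
  minimizers.
\<close>

lemma ex1_arg_min_regularized:
  fixes h :: "'a::euclidean_space \<Rightarrow> ereal"
  assumes h: "ext_closed h" "ext_convex h" "ext_proper h" and l: "l > 0"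
  shows "\<exists>!p. is_arg_min (\<lambda>z. h z + ereal (l / 2 * (norm (z - y))\<^sup>2)) (\<lambda>_. True) p"
proof (rule ex_ex1I)
  define \<phi> where "\<phi> = (\<lambda>z. h z + ereal (l / 2 * (norm (z - y))\<^sup>2))"
  obtain q c where aff: "\<And>z. ereal (q \<bullet> z + c) \<le> h z"
    using ext_convex_affine_minorant[OF h] by blast
  obtain u r where r: "h u = ereal r"
    using h(3) unfolding ext_proper_def by (metis ereal_cases less_irrefl)
  define r0 where "r0 = r + l / 2 * (norm (u - y))\<^sup>2"
  define E where "E = {(z, s). \<phi> z \<le> ereal s \<and> s \<le> r0}"
  have E_eq: "E = (\<lambda>e. (fst e, snd e - l / 2 * (norm (fst e - y))\<^sup>2)) -` ext_epigraph h \<inter> {e. snd e \<le> r0}"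
  proof -
    have "\<phi> z \<le> ereal s \<longleftrightarrow> h z \<le> ereal (s - l / 2 * (norm (z - y))\<^sup>2)" for z s
      by (cases "h z") (auto simp: \<phi>_def)
    then show ?thesis by (auto simp: E_def ext_epigraph_def)
  qed
  have "closed E"
    unfolding E_eq using h(1) unfolding ext_closed_def
    by (intro closed_Int continuous_closed_vimage closed_Collect_le continuous_intros)
      auto
  moreover have "bounded E"
  proof -
    define m where "m = q \<bullet> y + c"
    have bd: "norm (z - y) \<le> (norm q + \<bar>r0 - m\<bar> + l) / (l / 2) \<and> - (norm q) * norm (z - y) + m \<le> s \<and> s \<le> r0"
      if "(z, s) \<in> E" for z s
    proof -
      let ?n = "norm (z - y)"
      have "\<phi> z \<le> ereal s" and s: "s \<le> r0" using that by (auto simp: E_def)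
      then have *: "q \<bullet> z + c + l / 2 * ?n\<^sup>2 \<le> s"
        using aff[of z] by (cases "h z") (auto simp: \<phi>_def)
      have "- (norm q * ?n) \<le> q \<bullet> (z - y)"
        using Cauchy_Schwarz_ineq2[of q "z - y"] by linarith
      then have lo: "- (norm q * ?n) + m + l / 2 * ?n\<^sup>2 \<le> s"
        using * by (simp add: m_def inner_diff_right)
      have "?n \<le> (norm q + \<bar>r0 - m\<bar> + l) / (l / 2)"
      proof (rule ccontr)
        assume "\<not> ?thesis"
        then have big: "norm q + \<bar>r0 - m\<bar> + l < l / 2 * ?n"
          using l by (simp add: field_simps)
        have n1: "?n \<ge> 1"
        proof (rule ccontr)
          assume "\<not> 1 \<le> ?n"
          then have "l / 2 * ?n \<le> l / 2" using l by (intro mult_left_le) auto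
          with big l norm_ge_zero[of q] show False by linarith
        qed
        \<comment> \<open>Beyond this radius the excess of the quadratic over the linear term is more than the
          difference between the level \<open>r0\<close> and the affine minorant at \<open>y\<close>.\<close>
        have "\<bar>r0 - m\<bar> < (l / 2 * ?n - norm q) * 1" using big l by simp
        also have "\<dots> \<le> (l / 2 * ?n - norm q) * ?n"
          using big l n1 abs_ge_zero[of "r0 - m"] by (intro mult_left_mono) linarith+
        also have "\<dots> \<le> r0 - m" using lo s by (simp add: power2_eq_square algebra_simps)
        finally show False by simp
      qed
      moreover have "0 \<le> l / 2 * ?n\<^sup>2" using l by simp
      ultimately show ?thesis using lo s by linarith
    qed
    define N where "N = (norm q + \<bar>r0 - m\<bar> + l) / (l / 2)"
    have "E \<subseteq> cball y N \<times> {- (norm q) * N + m .. r0}"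
    proof (clarify, intro conjI SigmaI)
      fix z s assume "(z, s) \<in> E"
      note b = bd[OF this, folded N_def]
      then show "z \<in> cball y N" by (simp add: dist_norm norm_minus_commute)
      have "norm q * norm (z - y) \<le> norm q * N" using b by (intro mult_left_mono) auto
      then show "s \<in> {- (norm q) * N + m .. r0}" using b by auto
    qed
    then show ?thesis
      by (rule bounded_subset[rotated]) (intro bounded_Times bounded_cball bounded_closed_interval)
  qed
  ultimately have "compact E" by (simp add: compact_eq_bounded_closed)
  moreover have uE: "(u, r0) \<in> E" by (simp add: E_def \<phi>_def r r0_def)
  ultimately obtain e where e: "e \<in> E" "\<And>e'. e' \<in> E \<Longrightarrow> snd e \<le> snd e'"
    using continuous_attains_inf[of E snd] continuous_on_snd[OF continuous_on_id] by blast
  obtain p s where ps: "e = (p, s)" by (cases e)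
  have "\<phi> p \<le> \<phi> w" for w
  proof (rule ccontr)
    assume "\<not> \<phi> p \<le> \<phi> w"
    moreover have "\<phi> p \<le> ereal s" "s \<le> r0" using e(1) by (auto simp: ps E_def)
    ultimately have lt: "\<phi> w < ereal s" by auto
    then obtain v where v: "\<phi> w = ereal v"
      using h(3) by (cases "h w") (auto simp: \<phi>_def ext_proper_def)
    then have "(w, v) \<in> E" using lt \<open>s \<le> r0\<close> by (simp add: E_def)
    from e(2)[OF this] lt v show False by (simp add: ps)
  qed
  then show "\<exists>p. is_arg_min (\<lambda>z. h z + ereal (l / 2 * (norm (z - y))\<^sup>2)) (\<lambda>_. True) p"
    unfolding is_arg_min_linorder \<phi>_def by blast
next
  fix p p'
  assume p: "is_arg_min (\<lambda>z. h z + ereal (l / 2 * (norm (z - y))\<^sup>2)) (\<lambda>_. True) p"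
    and p': "is_arg_min (\<lambda>z. h z + ereal (l / 2 * (norm (z - y))\<^sup>2)) (\<lambda>_. True) p'"
  have "h p' + ereal (l / 2 * (norm (p' - y))\<^sup>2) \<le> h p + ereal (l / 2 * (norm (p - y))\<^sup>2)"
    using p' by (auto simp: is_arg_min_linorder)
  with arg_min_regularized_three_point(1)[OF h(2,3) p]
    arg_min_regularized_three_point(2)[OF h(2,3) p, of p']
    arg_min_regularized_three_point(1)[OF h(2,3) p']
  have "l / 2 * (norm (p' - p))\<^sup>2 \<le> 0"
    by (cases "h p"; cases "h p'") auto
  then show "p = p'" using l by (simp add: mult_le_0_iff)
qed

section \<open>Inertial iterations satisfying the three-point inequality\<close>

text \<open>
  The finite-valued core of the method: \<open>G\<close> holds the real objective values on the effective domain
  \<open>D\<close>, and \<open>step\<close> is the three-point inequality for a proximal step, combined with the bounds on the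
  model. The function \<open>max\<^sub>i (G i z - G i (x k))\<close> appears through its upper bounds \<open>M\<close>.
\<close>

locale inertial_descent =
  fixes G :: "'m::finite \<Rightarrow> 'a::real_inner \<Rightarrow> real" and D :: "'a set"
    and l a b :: real and x y :: "nat \<Rightarrow> 'a" and t :: "nat \<Rightarrow> real"
  assumes l_pos: "0 < l" and a_range: "0 \<le> a" "a < 1" and b_range: "a\<^sup>2 / 4 \<le> b" "b \<le> 1 / 4"
    and t_1: "t 1 = 1" and y_1: "y 1 = x 0"
    and t_Suc: "\<And>k. k \<ge> 1 \<Longrightarrow> t (Suc k) = sqrt ((t k)\<^sup>2 - a * t k + b) + 1 / 2"
    and y_Suc: "\<And>k. k \<ge> 1 \<Longrightarrow> y (Suc k) = x k + ((t k - 1) / t (Suc k)) *\<^sub>R (x k - x (k - 1))"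
    and x_mem: "\<And>k. x k \<in> D"
    and step: "\<And>k z M j. z \<in> D \<Longrightarrow> (\<And>i. G i z - G i (x k) \<le> M) \<Longrightarrow>
        G j (x (Suc k)) - G j (x k) + l / 2 * (norm (z - x (Suc k)))\<^sup>2
          \<le> M + l / 2 * (norm (z - y (Suc k)))\<^sup>2"
begin

lemma t_increment_pos: "0 < (1 - a) / 2"
  using a_range by simp

text \<open>
  The hypotheses on \<open>b\<close> enter here: \<open>b \<ge> a\<^sup>2 / 4\<close> puts \<open>(t - a / 2)\<^sup>2\<close> below the radicand, and
  \<open>b \<le> 1 / 4\<close> puts the radicand below \<open>(t + 1 / 2)\<^sup>2\<close>.
\<close>

lemma t_Suc_bounds:
  assumes "k \<ge> 1" "t k \<ge> 1"
  shows "t k + (1 - a) / 2 \<le> t (Suc k)" "t (Suc k) \<le> t k + 1"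
    "(t (Suc k))\<^sup>2 - t (Suc k) = (t k)\<^sup>2 - (a * t k + (1 / 4 - b))"
proof -
  let ?q = "(t k)\<^sup>2 - a * t k + b"
  have lo: "(t k - a / 2)\<^sup>2 \<le> ?q" using b_range by (simp add: power2_eq_square algebra_simps)
  then have q: "0 \<le> ?q" by (rule order_trans[OF zero_le_power2])
  from real_le_rsqrt[OF lo] show "t k + (1 - a) / 2 \<le> t (Suc k)"
    by (simp add: t_Suc[OF assms(1)] diff_divide_distrib)
  have "0 \<le> a * t k" using a_range assms by simp
  then have "?q \<le> (t k + 1 / 2)\<^sup>2" using b_range assms by (simp add: power2_eq_square algebra_simps)
  then have "sqrt ?q \<le> t k + 1 / 2" using assms by (intro real_le_lsqrt) auto
  then show "t (Suc k) \<le> t k + 1" by (simp add: t_Suc[OF assms(1)])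
  have "(sqrt ?q)\<^sup>2 = ?q" using q by simp
  then show "(t (Suc k))\<^sup>2 - t (Suc k) = (t k)\<^sup>2 - (a * t k + (1 / 4 - b))"
    unfolding t_Suc[OF assms(1)] by (simp add: power2_eq_square algebra_simps)
qed

lemma t_bounds:
  assumes "k \<ge> 1"
  shows "1 \<le> t k \<and> (1 - a) / 2 * real k \<le> t k \<and> t k \<le> real k"
  using assms
proof (induction k rule: dec_induct)
  case base
  then show ?case using t_1 a_range by auto
next
  case (step k)
  have "(1 - a) / 2 * real (Suc k) = (1 - a) / 2 * real k + (1 - a) / 2"
    by (simp add: field_simps)
  moreover have "t k + (1 - a) / 2 \<le> t (Suc k)" "t (Suc k) \<le> t k + 1"
    using t_Suc_bounds[OF step(1)] step.IH by auto
  moreover have "real (Suc k) = real k + 1" by simp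
  ultimately show ?case using step.IH t_increment_pos by (intro conjI; linarith)
qed

text \<open>
  By the recursion for \<open>t\<close>, this is the difference of the two sides of the inequality
  \<open>t\<^sub>k\<^sub>+\<^sub>1\<^sup>2 - t\<^sub>k\<^sub>+\<^sub>1 \<le> t\<^sub>k\<^sup>2\<close> on which accelerated gradient methods rest. It vanishes for \<open>a = 0\<close>,
  \<open>b = 1 / 4\<close>.
\<close>

definition slack where "slack k = a * t k + (1 / 4 - b)"
definition slack_sum where "slack_sum k = (\<Sum>j = 1..k. slack j)"

lemma slack_nonneg: "k \<ge> 1 \<Longrightarrow> 0 \<le> slack k"
  using t_bounds[of k] a_range b_range by (simp add: slack_def)

lemma slack_sum_nonneg: "0 \<le> slack_sum k"
  unfolding slack_sum_def by (intro sum_nonneg) (simp add: slack_nonneg)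

lemma slack_sum_Suc: "slack_sum (Suc k) = slack_sum k + slack (Suc k)"
  by (simp add: slack_sum_def)

lemma t_square_le_sum:
  assumes "k \<ge> 1"
  shows "(t k)\<^sup>2 \<le> (\<Sum>j = 1..k. t j)"
  using assms
proof (induction k rule: dec_induct)
  case base
  then show ?case using t_1 by simp
next
  case (step k)
  then show ?case using t_Suc_bounds(3)[of k] t_bounds[of k] slack_nonneg[of k] by (simp add: slack_def)
qed

text \<open>
  Splitting the slack into its two parts, the part proportional to \<open>t\<close> is controlled by
  \<open>t\<^sub>k\<^sup>2 \<le> t\<^sub>1 + \<dots> + t\<^sub>k\<close>, the constant part by \<open>t\<^sub>k \<le> k\<close>.
\<close>

lemma t_mult_slack_le_slack_sum:
  assumes "k \<ge> 1"
  shows "t k * slack k \<le> slack_sum k"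
proof -
  have "t k * slack k = a * (t k)\<^sup>2 + t k * (1 / 4 - b)"
    by (simp add: slack_def power2_eq_square algebra_simps)
  also have "\<dots> \<le> a * (\<Sum>j = 1..k. t j) + real k * (1 / 4 - b)"
    using t_square_le_sum[OF assms] t_bounds[OF assms] a_range b_range
    by (intro add_mono mult_left_mono mult_right_mono) auto
  also have "\<dots> = slack_sum k" by (simp add: slack_sum_def slack_def sum.distrib sum_distrib_left)
  finally show ?thesis .
qed

text \<open>
  The natural subtraction \<open>0 - 1 = 0\<close> makes this \<open>0\<close> at \<open>k = 0\<close>, in agreement with \<open>y 1 = x 0\<close>.
\<close>

definition sq_step where "sq_step k = (norm (x k - x (k - 1)))\<^sup>2"

lemma sq_step_nonneg: "0 \<le> sq_step k" by (simp add: sq_step_def)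

text \<open>
  The momentum coefficient is at most \<open>1 - 1 / t\<^sub>k\<close> because \<open>t\<close> increases. The loss of the fraction
  \<open>1 / t\<^sub>k\<close> of the squared step is what pays for the slack.
\<close>

lemma extrapolation_contracts:
  assumes "k \<ge> 1"
  shows "(norm (y (Suc k) - x k))\<^sup>2 \<le> (1 - 1 / t k) * sq_step k"
proof -
  define \<gamma> where "\<gamma> = (t k - 1) / t (Suc k)"
  have t_ge_1: "1 \<le> t k" using t_bounds[OF assms] by simp
  have t_mono: "t k \<le> t (Suc k)"
    using t_Suc_bounds(1)[OF assms t_ge_1] t_increment_pos by linarith
  note t = t_ge_1 t_mono
  have \<gamma>: "0 \<le> \<gamma>" "\<gamma> \<le> 1 - 1 / t k"
  proof -
    show "0 \<le> \<gamma>" using t by (simp add: \<gamma>_def)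
    have "\<gamma> \<le> (t k - 1) / t k" unfolding \<gamma>_def using t by (intro divide_left_mono) auto
    also have "\<dots> = 1 - 1 / t k" using t by (simp add: field_simps)
    finally show "\<gamma> \<le> 1 - 1 / t k" .
  qed
  have "\<gamma>\<^sup>2 \<le> \<gamma>"
  proof -
    have "0 < 1 / t k" using t by simp
    then have "\<gamma> \<le> 1" using \<gamma>(2) by linarith
    then show ?thesis using \<gamma>(1) by (simp add: power2_eq_square mult_left_le)
  qed
  have "(norm (y (Suc k) - x k))\<^sup>2 = \<gamma>\<^sup>2 * sq_step k"
    by (simp add: y_Suc[OF assms] \<gamma>_def sq_step_def power_mult_distrib power_divide)
  also have "\<dots> \<le> (1 - 1 / t k) * sq_step k"
    using \<open>\<gamma>\<^sup>2 \<le> \<gamma>\<close> \<gamma> sq_step_nonneg by (intro mult_right_mono) auto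
  finally show ?thesis .
qed

lemma extrapolation_le: "(norm (y (Suc k) - x k))\<^sup>2 \<le> sq_step k"
proof (cases "k = 0")
  case True
  then show ?thesis using y_1 by (simp add: sq_step_def)
next
  case False
  then have "(1 - 1 / t k) * sq_step k \<le> 1 * sq_step k"
    using t_bounds[of k] by (intro mult_right_mono) (auto simp: sq_step_nonneg)
  with extrapolation_contracts[of k] False show ?thesis by simp
qed

lemma component_step:
  "G j (x (Suc k)) - G j (x k) \<le> l / 2 * (norm (y (Suc k) - x k))\<^sup>2 - l / 2 * sq_step (Suc k)"
  using step[OF x_mem, of k k 0 j] by (simp add: sq_step_def norm_minus_commute)

text \<open>
  Each objective plus kinetic energy decreases along the iteration, although the objective alone may
  increase from one iterate to the next.
\<close>

lemma component_energy_le: "G j (x k) + l / 2 * sq_step k \<le> G j (x 0)"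
proof (induction k)
  case (Suc k)
  have "l / 2 * (norm (y (Suc k) - x k))\<^sup>2 \<le> l / 2 * sq_step k"
    using extrapolation_le l_pos by (intro mult_left_mono) auto
  with Suc component_step[of j k] show ?case by linarith
qed (simp add: sq_step_def)

text \<open>
  The quantity under the supremum in the merit function. It has no sign in general: since the
  objectives may increase temporarily, \<open>gap z j\<close> can be negative for some \<open>j < k\<close> even if \<open>z\<close> dominates
  \<open>x k\<close>.
\<close>

definition gap where "gap z k = Min (range (\<lambda>i. G i (x k) - G i z))"

lemma gap_le: "gap z k \<le> G i (x k) - G i z"
  by (simp add: gap_def)

lemma gap_attained: obtains i where "gap z k = G i (x k) - G i z"
proof -
  have "gap z k \<in> range (\<lambda>i. G i (x k) - G i z)" unfolding gap_def by (rule Min_in) auto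
  then show thesis using that by auto
qed

lemma gap_Suc_diff_le:
  "gap z (Suc k) - gap z k \<le> l / 2 * (norm (y (Suc k) - x k))\<^sup>2 - l / 2 * sq_step (Suc k)"
proof -
  obtain i where "gap z k = G i (x k) - G i z" by (rule gap_attained)
  with gap_le[of z "Suc k" i] component_step[of i k] show ?thesis by linarith
qed

lemma gap_Suc_le:
  assumes "z \<in> D"
  shows "gap z (Suc k) \<le> l / 2 * (norm (y (Suc k) - z))\<^sup>2 - l / 2 * (norm (x (Suc k) - z))\<^sup>2"
proof -
  obtain i where i: "gap z k = G i (x k) - G i z" by (rule gap_attained)
  have "G j z - G j (x k) \<le> - gap z k" for j using gap_le[of z k j] by linarith
  from step[OF assms this, of i] i gap_le[of z "Suc k" i] show ?thesis
    by (simp add: norm_minus_commute)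
qed

text \<open>
  The extrapolation is chosen such that \<open>t\<^sub>k x\<^sub>k - (t\<^sub>k - 1) x\<^sub>k\<^sub>-\<^sub>1 = t\<^sub>k\<^sub>+\<^sub>1 y\<^sub>k\<^sub>+\<^sub>1 - (t\<^sub>k\<^sub>+\<^sub>1 - 1) x\<^sub>k\<close>.
\<close>

definition sq_lead where "sq_lead z k = (norm (t k *\<^sub>R x k - (t k - 1) *\<^sub>R x (k - 1) - z))\<^sup>2"

text \<open>
  The step estimate with comparison point \<open>x k\<close>, weighted by \<open>T (T - 1)\<close>, is added to the one with
  comparison point \<open>z\<close>, weighted by \<open>T\<close>, where \<open>T = t\<^sub>k\<^sub>+\<^sub>1\<close>. Stewart's identity completes the squares
  on both sides.
\<close>

lemma weighted_step:
  assumes "k \<ge> 1" "z \<in> D"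
  shows "(t (Suc k))\<^sup>2 * gap z (Suc k) + l / 2 * sq_lead z (Suc k)
    \<le> ((t k)\<^sup>2 - slack k) * gap z k + l / 2 * sq_lead z k"
proof -
  define T where "T = t (Suc k)"
  have T: "T \<ge> 1" using t_bounds[of "Suc k"] by (simp add: T_def)
  have TT: "T\<^sup>2 - T = (t k)\<^sup>2 - slack k"
    using t_Suc_bounds(3)[OF assms(1)] t_bounds[OF assms(1)] by (simp add: T_def slack_def)
  have stewart: "T * ((T - 1) * (norm (v - u))\<^sup>2 + (norm (v - z))\<^sup>2)
      = (norm (T *\<^sub>R v - (T - 1) *\<^sub>R u - z))\<^sup>2 + (T - 1) * (norm (u - z))\<^sup>2" for u v :: 'a
    by (simp add: power2_norm_eq_inner inner_simps inner_commute algebra_simps)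
  have ext: "T *\<^sub>R y (Suc k) - (T - 1) *\<^sub>R x k = t k *\<^sub>R x k - (t k - 1) *\<^sub>R x (k - 1)"
  proof -
    have "T *\<^sub>R y (Suc k) = T *\<^sub>R x k + (t k - 1) *\<^sub>R (x k - x (k - 1))"
      using T by (simp add: y_Suc[OF assms(1)] T_def scaleR_add_right)
    then show ?thesis by (simp add: algebra_simps)
  qed
  have "T\<^sup>2 * gap z (Suc k) - (T\<^sup>2 - T) * gap z k
      = T * ((T - 1) * (gap z (Suc k) - gap z k) + gap z (Suc k))"
    by (simp add: power2_eq_square algebra_simps)
  also have "\<dots> \<le> T * ((T - 1) * (l / 2 * (norm (y (Suc k) - x k))\<^sup>2 - l / 2 * sq_step (Suc k))
      + (l / 2 * (norm (y (Suc k) - z))\<^sup>2 - l / 2 * (norm (x (Suc k) - z))\<^sup>2))"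
    using T gap_Suc_diff_le gap_Suc_le[OF assms(2)] by (intro mult_left_mono add_mono) auto
  also have "\<dots> = l / 2 * (T * ((T - 1) * (norm (y (Suc k) - x k))\<^sup>2 + (norm (y (Suc k) - z))\<^sup>2))
      - l / 2 * (T * ((T - 1) * (norm (x (Suc k) - x k))\<^sup>2 + (norm (x (Suc k) - z))\<^sup>2))"
  proof -
    have "T * ((T - 1) * (\<kappa> * A - \<kappa> * B) + (\<kappa> * P - \<kappa> * Q))
        = \<kappa> * (T * ((T - 1) * A + P)) - \<kappa> * (T * ((T - 1) * B + Q))" for \<kappa> A B P Q
      by (simp add: algebra_simps)
    then show ?thesis unfolding sq_step_def diff_Suc_1 .
  qed
  also have "\<dots> = l / 2 * sq_lead z k - l / 2 * sq_lead z (Suc k)"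
    unfolding stewart ext by (simp add: sq_lead_def T_def algebra_simps)
  finally show ?thesis unfolding T_def[symmetric] TT[symmetric] by linarith
qed

text \<open>
  The first two terms alone change by at most \<open>- slack k * gap z k\<close>, which is positive when the gap is
  negative. The last term, the energy of the gap weighted by the slack collected so far, compensates
  for this.
\<close>

definition lyapunov where
  "lyapunov z k = (t k)\<^sup>2 * gap z k + l / 2 * sq_lead z k + slack_sum (k - 1) * (gap z k + l / 2 * sq_step k)"

text \<open>
  Since \<open>slack_sum k = slack_sum (k - 1) + slack k\<close>, the new weight of the energy contributes
  \<open>slack k * (gap z k + l / 2 * sq_step k)\<close>. Its first part cancels the loss in the weighted step, and
  its second part is covered by the dissipation \<open>slack_sum k * (l / 2 * sq_step k / t k)\<close> of the energy.
\<close>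

lemma lyapunov_Suc_le:
  assumes "k \<ge> 1" "z \<in> D"
  shows "lyapunov z (Suc k) \<le> lyapunov z k"
proof -
  have t: "1 \<le> t k" using t_bounds[OF assms(1)] by simp
  have slack_sum_k: "slack_sum k = slack_sum (k - 1) + slack k" using slack_sum_Suc[of "k - 1"] assms by simp
  have "l / 2 * (norm (y (Suc k) - x k))\<^sup>2 \<le> l / 2 * ((1 - 1 / t k) * sq_step k)"
    using extrapolation_contracts[OF assms(1)] l_pos by (intro mult_left_mono) auto
  also have "\<dots> = l / 2 * sq_step k - l / 2 * (sq_step k / t k)" by (simp add: algebra_simps)
  finally have "gap z (Suc k) + l / 2 * sq_step (Suc k) \<le> gap z k + l / 2 * sq_step k - l / 2 * (sq_step k / t k)"
    using gap_Suc_diff_le[of z k] by linarith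
  then have "slack_sum k * (gap z (Suc k) + l / 2 * sq_step (Suc k))
      \<le> slack_sum k * (gap z k + l / 2 * sq_step k - l / 2 * (sq_step k / t k))"
    by (intro mult_left_mono slack_sum_nonneg)
  moreover have "slack k * (l / 2 * sq_step k) \<le> slack_sum k * (l / 2 * (sq_step k / t k))"
  proof -
    have "slack k * (l / 2 * sq_step k) = t k * slack k * (l / 2 * (sq_step k / t k))" using t by simp
    also have "\<dots> \<le> slack_sum k * (l / 2 * (sq_step k / t k))"
      using t l_pos sq_step_nonneg t_mult_slack_le_slack_sum[OF assms(1)] by (intro mult_right_mono) auto
    finally show ?thesis .
  qed
  moreover have "slack_sum k * (gap z k + e - q)
      = slack_sum (k - 1) * (gap z k + e) + slack k * gap z k + slack k * e - slack_sum k * q" for e q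
    unfolding slack_sum_k by (simp add: algebra_simps)
  moreover have "((t k)\<^sup>2 - slack k) * gap z k = (t k)\<^sup>2 * gap z k - slack k * gap z k"
    by (rule left_diff_distrib)
  ultimately show ?thesis
    using weighted_step[OF assms] unfolding lyapunov_def diff_Suc_1 by smt
qed

lemma lyapunov_le:
  assumes "k \<ge> 1" "z \<in> D"
  shows "lyapunov z k \<le> l / 2 * (norm (z - x 0))\<^sup>2"
  using assms(1)
proof (induction k rule: dec_induct)
  case base
  then show ?case
    using gap_Suc_le[OF assms(2), of 0] t_1 y_1 by (simp add: lyapunov_def sq_lead_def slack_sum_def norm_minus_commute)
next
  case (step k)
  then show ?case using lyapunov_Suc_le[OF step(1) assms(2)] by linarith
qed

text \<open>
  A nonnegative gap makes every term of the Lyapunov function nonnegative, so the first one is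
  bounded by the initial value; and \<open>t\<close> grows at least linearly.
\<close>

lemma gap_quadratic_bound:
  assumes "k \<ge> 1" "z \<in> D" "0 \<le> gap z k"
  shows "((1 - a) / 2 * real k)\<^sup>2 * gap z k \<le> l / 2 * (norm (z - x 0))\<^sup>2"
proof -
  have "((1 - a) / 2 * real k)\<^sup>2 * gap z k \<le> (t k)\<^sup>2 * gap z k"
    using t_bounds[OF assms(1)] a_range assms(3) by (intro mult_right_mono power_mono) auto
  also have "\<dots> \<le> lyapunov z k"
    using slack_sum_nonneg l_pos assms(3) sq_step_nonneg by (simp add: lyapunov_def sq_lead_def)
  also note lyapunov_le[OF assms(1,2)]
  finally show ?thesis .
qed

end

section \<open>The proximal step for the max-model\<close>

text \<open>
  Adding an affine function changes the epigraph by a vertical translation and an invertible linear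
  shear.
\<close>

lemma affine_perturbation:
  fixes h :: "'a::euclidean_space \<Rightarrow> ereal"
  assumes "ext_closed h" "ext_convex h"
  shows "ext_closed (\<lambda>z. h z + ereal (q \<bullet> z + c))" "ext_convex (\<lambda>z. h z + ereal (q \<bullet> z + c))"
proof -
  let ?S = "\<lambda>e::'a \<times> real. (fst e, snd e - q \<bullet> fst e)"
  have "h z + ereal (q \<bullet> z + c) \<le> ereal r \<longleftrightarrow> h z \<le> ereal (r - q \<bullet> z - c)" for z r
    by (cases "h z") auto
  then have eq: "ext_epigraph (\<lambda>z. h z + ereal (q \<bullet> z + c))
      = ?S -` ((\<lambda>e. (0, c) + e) ` ext_epigraph h)"
    by (force simp: ext_epigraph_def image_iff algebra_simps)
  have lin: "linear ?S"
    by (intro linearI) (auto simp: inner_simps algebra_simps)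
  show "ext_closed (\<lambda>z. h z + ereal (q \<bullet> z + c))"
    unfolding ext_closed_def eq using assms(1)
    by (intro continuous_closed_vimage closed_translation continuous_intros)
      (auto simp: ext_closed_def)
  show "ext_convex (\<lambda>z. h z + ereal (q \<bullet> z + c))"
    unfolding ext_convex_def eq using assms(2)
    by (intro convex_linear_vimage[OF lin] convex_translation) (auto simp: ext_convex_def)
qed

lemma ext_epigraph_Max:
  fixes h :: "'m::finite \<Rightarrow> 'a \<Rightarrow> ereal"
  shows "ext_epigraph (\<lambda>z. Max (range (\<lambda>i. h i z))) = (\<Inter>i. ext_epigraph (h i))"
  by (auto simp: ext_epigraph_def)

lemma vobj_eq_ereal:
  assumes g_proper: "\<And>i. ext_proper (g i)" and "z \<in> vdom (vobj f g)"
  shows "vobj f g z i = ereal (real_of_ereal (vobj f g z i))"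
    and "g i z = ereal (real_of_ereal (vobj f g z i) - f i z)"
proof -
  have "g i z \<noteq> -\<infinity>" using g_proper by (auto simp: ext_proper_def)
  moreover have "g i z \<noteq> \<infinity>" using assms(2) by (auto simp: vdom_def vobj_def)
  ultimately show "vobj f g z i = ereal (real_of_ereal (vobj f g z i))"
    "g i z = ereal (real_of_ereal (vobj f g z i) - f i z)"
    by (cases "g i z"; simp add: vobj_def)+
qed

text \<open>
  The subproblem minimizes a closed proper convex model plus the squared distance to \<open>y\<close>, so the
  three-point inequality holds at \<open>p\<close>. On the side of \<open>z\<close>, convexity of \<open>f\<close> bounds the model from above
  by \<open>max\<^sub>i (G i z - G i u)\<close>; on the side of \<open>p\<close>, the Lipschitz gradient and \<open>L i \<le> l\<close> show that the model
  plus the quadratic term bounds each \<open>G j p - G j u\<close>.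
\<close>

lemma prox_point_step:
  fixes f :: "'m::finite \<Rightarrow> 'a::euclidean_space \<Rightarrow> real"
    and u y :: 'a
  assumes f_convex: "\<And>i. convex_on UNIV (f i)"
    and f_grad: "\<And>i z. GDERIV (f i) z :> df i z"
    and f_lipschitz: "\<And>i. (L i)-lipschitz_on UNIV (df i)"
    and g_closed: "\<And>i. ext_closed (g i)"
    and g_proper: "\<And>i. ext_proper (g i)"
    and g_convex: "\<And>i. ext_convex (g i)"
    and l_pos: "l > 0" and L_le: "\<And>i. L i \<le> l"
    and u: "u \<in> vdom (vobj f g)"
  defines "p \<equiv> prox_point f df g l u y" and "G \<equiv> \<lambda>i z. real_of_ereal (vobj f g z i)"
  shows "p \<in> vdom (vobj f g)"
    and "z \<in> vdom (vobj f g) \<Longrightarrow> (\<And>i. G i z - G i u \<le> M) \<Longrightarrow>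
      G j p - G j u + l / 2 * (norm (z - p))\<^sup>2 \<le> M + l / 2 * (norm (z - y))\<^sup>2"
proof -
  define h where "h = (\<lambda>i z. g i z + ereal (df i y \<bullet> z + (f i y - df i y \<bullet> y - G i u)))"
  define H where "H = (\<lambda>z. Max (range (\<lambda>i. h i z)))"
  have obj: "prox_objective f df g l u y = (\<lambda>z. H z + ereal (l / 2 * (norm (z - y))\<^sup>2))"
  proof -
    have "ereal (df i y \<bullet> (z - y)) + g i z + ereal (f i y) - vobj f g u i = h i z" for i z
    proof -
      obtain r where "vobj f g u i = ereal r" using vobj_eq_ereal(1)[where g = g, OF g_proper u, of i] by blast
      then show ?thesis by (cases "g i z") (auto simp: h_def G_def inner_diff_right)
    qed
    then show ?thesis by (simp add: prox_objective_def H_def fun_eq_iff)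
  qed
  have h_dom: "h i z = ereal (df i y \<bullet> (z - y) + f i y - f i z + (G i z - G i u))"
    if "z \<in> vdom (vobj f g)" for i z
    using vobj_eq_ereal(2)[where g = g, OF g_proper that, of i] by (simp add: h_def G_def inner_diff_right)
  have H_le: "H z \<le> r \<longleftrightarrow> (\<forall>i. h i z \<le> r)" for z r by (auto simp: H_def)
  have closed: "ext_closed H" and convex: "ext_convex H"
    using affine_perturbation[OF g_closed g_convex]
    unfolding H_def h_def ext_closed_def ext_convex_def ext_epigraph_Max
    by (auto intro!: closed_INT convex_INT)
  have "H z \<noteq> -\<infinity>" for z
  proof
    assume "H z = -\<infinity>"
    then have "h undefined z = -\<infinity>" using H_le[of z "-\<infinity>"] by simp
    then show False using g_proper by (auto simp: h_def ext_proper_def)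
  qed
  moreover have "H u < \<infinity>"
  proof -
    have "H u \<in> range (\<lambda>i. h i u)" unfolding H_def by (rule Max_in) auto
    then show ?thesis by (auto simp: h_dom[OF u])
  qed
  ultimately have proper: "ext_proper H" by (auto simp: ext_proper_def)
  have argmin: "is_arg_min (\<lambda>z. H z + ereal (l / 2 * (norm (z - y))\<^sup>2)) (\<lambda>_. True) p"
    using theI'[OF ex1_arg_min_regularized[OF closed convex proper l_pos, of y]]
    by (simp add: p_def prox_point_def obj)
  note tp = arg_min_regularized_three_point[OF convex proper argmin]
  then have "H p < \<infinity>" by auto
  then have "h i p < \<infinity>" for i using H_le[of p "H p"] by (blast intro: le_less_trans)
  then have "g i p < \<infinity>" for i by (cases "g i p") (auto simp: h_def dest: spec)
  then show pdom: "p \<in> vdom (vobj f g)"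
    by (auto simp: vdom_def vobj_def)
  assume z: "z \<in> vdom (vobj f g)" and M: "\<And>i. G i z - G i u \<le> M"
  have "h i z \<le> ereal M" for i
    using convex_gradient_minorant[OF f_convex f_grad, of i y z] M[of i] by (simp add: h_dom[OF z])
  then have "H z \<le> ereal M" by (simp add: H_le)
  obtain r where r: "H p = ereal r" using tp(1) by auto
  have "ereal (r + l / 2 * (norm (p - y))\<^sup>2 + l / 2 * (norm (z - p))\<^sup>2)
      \<le> ereal M + ereal (l / 2 * (norm (z - y))\<^sup>2)"
    using order_trans[OF tp(2) add_right_mono[OF \<open>H z \<le> ereal M\<close>]]
    by (simp add: r add.assoc)
  then have "r + l / 2 * (norm (p - y))\<^sup>2 + l / 2 * (norm (z - p))\<^sup>2 \<le> M + l / 2 * (norm (z - y))\<^sup>2"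
    by simp
  moreover have "G j p - G j u \<le> r + l / 2 * (norm (p - y))\<^sup>2"
  proof -
    have "L j / 2 * (norm (p - y))\<^sup>2 \<le> l / 2 * (norm (p - y))\<^sup>2"
      using L_le by (intro mult_right_mono) auto
    moreover have "h j p \<le> ereal r" using H_le[of p "ereal r"] r by simp
    ultimately show ?thesis
      using lipschitz_gradient_majorant[OF f_grad f_lipschitz, of j p y] by (simp add: h_dom[OF pdom])
  qed
  ultimately show "G j p - G j u + l / 2 * (norm (z - p))\<^sup>2 \<le> M + l / 2 * (norm (z - y))\<^sup>2"
    by linarith
qed

section \<open>The merit function and the convergence rate\<close>

text \<open>
  Only points \<open>z\<close> with a positive minimum matter, and those dominate \<open>u\<close>. Such a \<open>z\<close> can be replaced
  by a weakly Pareto optimal point \<open>p\<close> below it, which only increases the minimum. The minimum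
  depends on \<open>p\<close> through \<open>F p\<close> alone, so the quadratic bound holds with every point of the fibre of
  \<open>F p\<close> in place of \<open>p\<close>; the infimum of their squared distances to \<open>x0\<close> is at most \<open>R\<close>.
\<close>

lemma merit_le:
  fixes F :: "'a::euclidean_space \<Rightarrow> 'm::finite \<Rightarrow> ereal"
  assumes F: "\<And>z i. F z i \<noteq> -\<infinity>"
    and B: "assumption_B F x0"
    and u: "u \<in> vdom F" "u \<in> level_set F (F x0)"
    and c: "0 < c" and R0: "0 \<le> R"
    and gap: "\<And>z. z \<in> vdom F \<Longrightarrow>
        0 \<le> Min (range (\<lambda>i. real_of_ereal (F u i) - real_of_ereal (F z i))) \<Longrightarrow>
        Min (range (\<lambda>i. real_of_ereal (F u i) - real_of_ereal (F z i))) \<le> c * (norm (z - x0))\<^sup>2"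
    and R: "(SUP Fs\<in>F ` (weakly_pareto F \<inter> level_set F (F x0)).
       INF z\<in>F -` {Fs}. ereal ((norm (z - x0))\<^sup>2)) \<le> ereal R"
  shows "merit F u \<le> ereal (c * R)"
  unfolding merit_def
proof (rule SUP_least)
  fix z
  define m where "m = (\<lambda>z. Min (range (\<lambda>i. F u i - F z i)))"
  define m' where "m' = (\<lambda>z. Min (range (\<lambda>i. real_of_ereal (F u i) - real_of_ereal (F z i))))"
  have gap': "m' v \<le> c * (norm (v - x0))\<^sup>2" if "v \<in> vdom F" "0 \<le> m' v" for v
    using gap that unfolding m'_def by blast
  have le_F: "F v i \<le> F u i" if "0 < m v" for v i
  proof -
    have "0 < F u i - F v i" using that by (simp add: m_def)
    then show ?thesis using F[of u i] F[of v i] by (cases "F u i"; cases "F v i") auto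
  qed
  have m_real: "m v = ereal (m' v)" if v: "v \<in> vdom F" for v
  proof -
    have fin: "F w i = ereal (real_of_ereal (F w i))" if "w \<in> vdom F" for w i
      using that F[of w i] by (cases "F w i") (auto simp: vdom_def less_top[symmetric] dest: spec[of _ i])
    have "F u i - F v i = ereal (real_of_ereal (F u i) - real_of_ereal (F v i))" for i
      using fin[OF u(1), of i] fin[OF v, of i] by (metis ereal_minus(1))
    then have "range (\<lambda>i. F u i - F v i)
        = ereal ` range (\<lambda>i. real_of_ereal (F u i) - real_of_ereal (F v i))"
      by (auto simp: image_iff)
    then show ?thesis
      unfolding m_def m'_def
      by (simp add: mono_Min_commute[of ereal, symmetric] mono_def)
  qed
  show "Min (range (\<lambda>i. F u i - F z i)) \<le> ereal (c * R)"
  proof (cases "0 < m z")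
    case False
    then have "m z \<le> 0" by simp
    also have "0 \<le> ereal (c * R)" using c R0 by simp
    finally show ?thesis by (simp add: m_def)
  next
    case True
    have "z \<in> level_set F (F x0)"
      using u(2) le_F[OF True] by (auto simp: level_set_def intro: order_trans)
    then obtain p where p: "p \<in> weakly_pareto F" "\<And>i. F p i \<le> F z i"
      using B by (auto simp: assumption_B_def)
    have mp: "m z \<le> m p"
      using p(2) by (auto simp: m_def intro!: Min.boundedI Min.coboundedI[THEN order_trans] ereal_minus_mono)
    with True have pos: "0 < m p" by simp
    have p_dom: "p \<in> vdom F"
      using le_F[OF pos] u(1) unfolding vdom_def by (blast intro: le_less_trans)
    have "ereal (m' p / c) \<le> (INF v\<in>F -` {F p}. ereal ((norm (v - x0))\<^sup>2))"
    proof (rule INF_greatest)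
      fix v assume v: "v \<in> F -` {F p}"
      then have "v \<in> vdom F" using p_dom by (auto simp: vdom_def)
      moreover have "m' v = m' p" using v by (simp add: m'_def)
      ultimately have "m' p \<le> c * (norm (v - x0))\<^sup>2"
        using gap'[of v] pos m_real[OF p_dom] by simp
      then show "ereal (m' p / c) \<le> ereal ((norm (v - x0))\<^sup>2)" using c by (simp add: field_simps)
    qed
    also have "\<dots> \<le> ereal R"
    proof (rule order_trans[OF SUP_upper R])
      show "F p \<in> F ` (weakly_pareto F \<inter> level_set F (F x0))"
        using p \<open>z \<in> level_set F (F x0)\<close> by (auto simp: level_set_def intro: order_trans)
    qed
    finally have "m' p \<le> c * R" using c by (simp add: field_simps)
    then have "m p \<le> ereal (c * R)" using m_real[OF p_dom] by simp
    with mp have "m z \<le> ereal (c * R)" by (rule order_trans)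
    then show ?thesis by (simp only: m_def)
  qed
qed

theorem theorem5:
  fixes f :: "'m::finite \<Rightarrow> real ^ 'n \<Rightarrow> real"
    and df :: "'m \<Rightarrow> real ^ 'n \<Rightarrow> real ^ 'n"
    and g :: "'m \<Rightarrow> real ^ 'n \<Rightarrow> ereal"
    and L :: "'m \<Rightarrow> real"
    and l a b :: real
    and x y :: "nat \<Rightarrow> real ^ 'n"
    and t :: "nat \<Rightarrow> real"
  assumes f_convex: "\<And>i. convex_on UNIV (f i)"
    and f_grad: "\<And>i z. GDERIV (f i) z :> df i z"
    and f_C1: "\<And>i. continuous_on UNIV (df i)"
    and L_pos: "\<And>i. L i > 0"
    and f_lipschitz: "\<And>i. (L i)-lipschitz_on UNIV (df i)"
    and g_closed: "\<And>i. ext_closed (g i)"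
    and g_proper: "\<And>i. ext_proper (g i)"
    and g_convex: "\<And>i. ext_convex (g i)"
    and l_ge: "l \<ge> Max (range L)"
    and a_range: "a \<in> {0..<1}"
    and b_range: "b \<in> {a\<^sup>2 / 4..1 / 4}"
    and alg: "apg_sequence f df g l a b x y t"
  shows "(\<forall>i k. vobj f g (x k) i \<le> vobj f g (x 0) i) \<and>
    (assumption_B (vobj f g) (x 0) \<longrightarrow>
       (\<forall>\<^sub>F k in sequentially. \<bar>merit (vobj f g) (x k)\<bar> \<noteq> \<infinity>) \<and>
       (\<lambda>k. real_of_ereal (merit (vobj f g) (x k))) \<in> O(\<lambda>k. 1 / (real k)\<^sup>2))"
proof -
  define F where "F = vobj f g"
  define G where "G = (\<lambda>i z. real_of_ereal (F z i))"
  have L_le: "L i \<le> l" for i using l_ge by auto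
  have l_pos: "0 < l" using L_pos L_le order_less_le_trans by blast
  note step = prox_point_step[OF f_convex f_grad f_lipschitz g_closed g_proper g_convex l_pos L_le]
  have x_Suc: "x (Suc k) = prox_point f df g l (x k) (y (Suc k))" for k
    using alg unfolding apg_sequence_def by (metis Suc_eq_plus1 diff_Suc_1 le_add2)
  have x_dom: "x k \<in> vdom F" for k
  proof (induction k)
    case 0
    then show ?case using alg by (simp add: apg_sequence_def F_def)
  next
    case (Suc k)
    then show ?case using step(1) x_Suc by (simp add: F_def)
  qed
  interpret inertial_descent G "vdom F" l a b x y t
  proof
    fix k z M j
    assume "z \<in> vdom F" "\<And>i. G i z - G i (x k) \<le> M"
    then show "G j (x (Suc k)) - G j (x k) + l / 2 * (norm (z - x (Suc k)))\<^sup>2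
        \<le> M + l / 2 * (norm (z - y (Suc k)))\<^sup>2"
      using step(2)[where u = "x k" and z = z and M = M and j = j and y = "y (Suc k)"] x_dom
      by (simp add: G_def F_def x_Suc)
  qed (use alg a_range b_range l_pos x_dom in \<open>auto simp: apg_sequence_def\<close>)
  have F_fin: "F (x k) i = ereal (G i (x k))" for k i
    using vobj_eq_ereal(1)[where g = g and f = f, OF g_proper, of "x k" i] x_dom
    by (simp add: F_def G_def)
  have descent: "F (x k) i \<le> F (x 0) i" for k i
  proof -
    have "0 \<le> l / 2 * sq_step k" using l_pos sq_step_nonneg by simp
    with component_energy_le[of i k] show ?thesis by (simp add: F_fin)
  qed
  moreover have "(\<forall>\<^sub>F k in sequentially. \<bar>merit F (x k)\<bar> \<noteq> \<infinity>) \<and>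
      (\<lambda>k. real_of_ereal (merit F (x k))) \<in> O(\<lambda>k. 1 / (real k)\<^sup>2)" if B: "assumption_B F (x 0)"
  proof -
    let ?R = "SUP Fs\<in>F ` (weakly_pareto F \<inter> level_set F (F (x 0))).
       INF z\<in>F -` {Fs}. ereal ((norm (z - x 0))\<^sup>2)"
    have "?R < \<infinity>" using B by (simp add: assumption_B_def)
    then obtain r where "?R \<le> ereal r" by (cases ?R) auto
    then have "?R \<le> ereal (max 0 r)" by (rule order_trans) simp
    then obtain R where R: "0 \<le> R" "?R \<le> ereal R" using max.cobounded1 by blast
    \<comment> \<open>The linear lower bound \<open>(1 - a) / 2 * k\<close> for \<open>t k\<close> gives the denominator.\<close>
    define C where "C = l / 2 / ((1 - a) / 2)\<^sup>2 * R"
    have bounds: "0 \<le> merit F (x k)" "merit F (x k) \<le> ereal (C * (1 / (real k)\<^sup>2))" if k: "k \<ge> 1" for k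
    proof -
      let ?q = "((1 - a) / 2 * real k)\<^sup>2"
      have q: "0 < ?q" using k a_range by auto
      have "0 = Min (range (\<lambda>i. F (x k) i - F (x k) i))" by (simp add: F_fin zero_ereal_def)
      also have "\<dots> \<le> merit F (x k)" unfolding merit_def by (rule SUP_upper) simp
      finally show "0 \<le> merit F (x k)" .
      have "merit F (x k) \<le> ereal (l / 2 / ?q * R)"
      proof (rule merit_le[OF _ B x_dom])
        show "F z i \<noteq> -\<infinity>" for z i
          using g_proper[of i] by (simp add: F_def vobj_def ext_proper_def)
        show "x k \<in> level_set F (F (x 0))" using descent by (simp add: level_set_def)
        fix z assume z: "z \<in> vdom F"
          and nonneg: "0 \<le> Min (range (\<lambda>i. real_of_ereal (F (x k) i) - real_of_ereal (F z i)))"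
        have gap_eq: "gap z k = Min (range (\<lambda>i. real_of_ereal (F (x k) i) - real_of_ereal (F z i)))"
          unfolding gap_def by (simp only: G_def)
        have "?q * gap z k \<le> l / 2 * (norm (z - x 0))\<^sup>2"
          using gap_quadratic_bound[OF k z] nonneg gap_eq by simp
        then have "gap z k \<le> l / 2 * (norm (z - x 0))\<^sup>2 / ?q"
          unfolding pos_le_divide_eq[OF q] by (simp only: mult.commute)
        then show "Min (range (\<lambda>i. real_of_ereal (F (x k) i) - real_of_ereal (F z i)))
            \<le> l / 2 / ?q * (norm (z - x 0))\<^sup>2"
          unfolding gap_eq by simp
      qed (use q l_pos R in auto)
      also have "l / 2 / ?q * R = C * (1 / (real k)\<^sup>2)"
        unfolding C_def power_mult_distrib by simp
      finally show "merit F (x k) \<le> ereal (C * (1 / (real k)\<^sup>2))" .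
    qed
    have ev: "\<bar>merit F (x k)\<bar> \<noteq> \<infinity> \<and> norm (real_of_ereal (merit F (x k))) \<le> C * norm (1 / (real k)\<^sup>2)"
      if "k \<ge> 1" for k
      using bounds[OF that] by (cases "merit F (x k)") auto
    then have "\<forall>\<^sub>F k in sequentially. \<bar>merit F (x k)\<bar> \<noteq> \<infinity>"
      by (intro eventually_sequentiallyI[of 1]) auto
    moreover have "(\<lambda>k. real_of_ereal (merit F (x k))) \<in> O(\<lambda>k. 1 / (real k)\<^sup>2)"
      using ev by (intro bigoI[of _ C] eventually_sequentiallyI[of 1]) auto
    ultimately show ?thesis by blast
  qed
  ultimately show ?thesis unfolding F_def by blast
qed

end
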